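(* There exists a family of $n$-node directed graphs $G$ such that any reachability-preserving DAG cover of $G$ with at most $n^{2-o(1)}$ additional edges requires at least $n^{1-o(1)}$ DAGs.
   Context: Let $G$ be a (possibly weighted) directed graph with $n$ vertices and $m$ edges. A DAG cover of $G$ with $f$ additional edges and $g$ DAGs is a collection $D_1,\dots,D_g$ of directed acyclic graphs, each with vertex set $V(G)$, such that $\left|\left(\bigcup_i E(D_i)\right)\setminus E(G)\right|\le f$. The DAG cover is reachability-preserving if for all vertices $s,t\in V(G)$: $s$ can reach $t$ in $G$ if and only if there exists $i$ such that $s$ can reach $t$ in $D_i$. *)

theory Defs
  imports
    Complex_Main
    "HOL-Library.Landau_Symbols"
    "Graph_Theory.Pair_Digraph"
begin

(* An acyclic arc relation has no loops, so simple digraphs need not be required here. *)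
definition dag :: "'a pair_pre_digraph \<Rightarrow> bool" where
  "dag D \<longleftrightarrow> pair_fin_digraph D \<and> acyclic (parcs D)"

(* D 1, ..., D g is a DAG cover of G with f additional edges; values of D outside {1..g}
   are irrelevant and repetitions are allowed. The arcs are pairs of vertices, so the
   difference of arc sets below compares arcs by their end points. *)
definition dag_cover ::
  "'a pair_pre_digraph \<Rightarrow> nat \<Rightarrow> nat \<Rightarrow> (nat \<Rightarrow> 'a pair_pre_digraph) \<Rightarrow> bool" where
  "dag_cover G f g D \<longleftrightarrow>
     (\<forall>i\<in>{1..g}. dag (D i) \<and> pverts (D i) = pverts G) \<and>
     card ((\<Union>i\<in>{1..g}. parcs (D i)) - parcs G) \<le> f"

definition reachability_preserving ::
  "'a pair_pre_digraph \<Rightarrow> nat \<Rightarrow> (nat \<Rightarrow> 'a pair_pre_digraph) \<Rightarrow> bool" where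
  "reachability_preserving G g D \<longleftrightarrow>
     (\<forall>s\<in>pverts G. \<forall>t\<in>pverts G.
        reachable (with_proj G) s t \<longleftrightarrow> (\<exists>i\<in>{1..g}. reachable (with_proj (D i)) s t))"

end

theory Submission
  imports Defs "HOL-Real_Asymp.Real_Asymp"
begin

text \<open>
  The graph consists of two-cycles placed at the points of a grid with \<open>l\<close> levels, where \<open>l\<close> is
  polylogarithmic in \<open>n\<close>, and of arcs between consecutive levels that run along lines \<open>(a, b)\<close>,
  \<open>b\<close> ranging over a Behrend-type set \<open>B\<close>. Since no element of \<open>B\<close> is a nontrivial average of
  elements of \<open>B\<close>, the endpoints of a line are connected only along that line. There are
  \<open>n powr (2 - o(1))\<close> lines, and an arc outside the graph can serve at most one of them, so a
  constant fraction of the lines must be realised by the arcs of the graph and arcs inside the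
  two-cycles. Such a line prescribes at each level the direction in which its two-cycle is
  traversed, while a DAG fixes one direction per two-cycle. With random prescriptions, a union
  bound over all orientations of the two-cycles shows that every DAG realises only
  \<open>n powr (1 + o(1))\<close> of the lines.
\<close>

section \<open>Behrend sets\<close>

text \<open>Lists count multiplicity, since a path may repeat a slope; the product form avoids
  division.\<close>

definition average_free :: "nat \<Rightarrow> nat set \<Rightarrow> bool" where
  "average_free n B \<longleftrightarrow>
     (\<forall>bs b. set bs \<subseteq> B \<and> length bs = n \<and> b \<in> B \<and> sum_list bs = n * b \<longrightarrow> set bs \<subseteq> {b})"

section \<open>Base-\<open>Q\<close> expansions\<close>

definition digit_sum :: "nat \<Rightarrow> nat \<Rightarrow> (nat \<Rightarrow> nat) \<Rightarrow> nat" where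
  "digit_sum Q k x = (\<Sum>j<k. x j * Q ^ j)"

lemma digit_sum_Suc: "digit_sum Q (Suc k) x = x 0 + Q * digit_sum Q k (\<lambda>j. x (Suc j))"
  by (simp add: digit_sum_def sum.lessThan_Suc_shift sum_distrib_left mult_ac del: sum.lessThan_Suc)

lemma digit_sum_less:
  assumes "\<And>j. j < k \<Longrightarrow> x j < Q"
  shows "digit_sum Q k x < Q ^ k"
  using assms
proof (induction k arbitrary: x)
  case 0
  then show ?case by (simp add: digit_sum_def)
next
  case (Suc k)
  have "digit_sum Q k (\<lambda>j. x (Suc j)) + 1 \<le> Q ^ k"
    using Suc.IH[of "\<lambda>j. x (Suc j)"] Suc.prems by fastforce
  then have "Q * (digit_sum Q k (\<lambda>j. x (Suc j)) + 1) \<le> Q * Q ^ k"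
    by (rule mult_le_mono2)
  moreover have "x 0 < Q"
    using Suc.prems by simp
  ultimately show ?case
    by (simp add: digit_sum_Suc)
qed

text \<open>Reduction modulo \<open>Q\<close> isolates the lowest digit; cancelling it leaves the
  shifted expansions.\<close>

lemma digit_sum_inj:
  assumes "digit_sum Q k x = digit_sum Q k y"
    and "\<And>j. j < k \<Longrightarrow> x j < Q" and "\<And>j. j < k \<Longrightarrow> y j < Q" and "j < k"
  shows "x j = y j"
  using assms
proof (induction k arbitrary: x y j)
  case 0
  then show ?case by simp
next
  case (Suc k)
  let ?x = "digit_sum Q k (\<lambda>j. x (Suc j))" and ?y = "digit_sum Q k (\<lambda>j. y (Suc j))"
  have eq: "x 0 + Q * ?x = y 0 + Q * ?y"
    using Suc.prems(1) by (simp add: digit_sum_Suc)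
  have lt: "x 0 < Q" "y 0 < Q"
    using Suc.prems by auto
  have "(x 0 + Q * ?x) mod Q = (y 0 + Q * ?y) mod Q"
    using eq by simp
  then have x0: "x 0 = y 0"
    using lt by simp
  then have "?x = ?y"
    using eq lt by simp
  then have "x (Suc i) = y (Suc i)" if "i < k" for i
    using Suc.IH[of "\<lambda>j. x (Suc j)" "\<lambda>j. y (Suc j)" i] Suc.prems that by simp
  then show ?case
    using x0 Suc.prems(4) by (cases j) auto
qed

lemma sum_list_digit_sum:
  "sum_list (map (digit_sum Q k) vs) = digit_sum Q k (\<lambda>j. sum_list (map (\<lambda>w. w j) vs))"
  by (induction vs) (auto simp: digit_sum_def sum.distrib algebra_simps)

section \<open>Strict convexity of the sphere\<close>

lemma sum_list_sq_dist:
  fixes v :: "nat \<Rightarrow> nat"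
  assumes "\<And>w. w \<in> set vs \<Longrightarrow> (\<Sum>j<k. (w j)\<^sup>2) = r" and "(\<Sum>j<k. (v j)\<^sup>2) = r"
  shows "sum_list (map (\<lambda>w. \<Sum>j<k. (int (w j) - int (v j))\<^sup>2) vs) =
    2 * int (length vs) * int r - 2 * (\<Sum>j<k. int (v j) * int (sum_list (map (\<lambda>w. w j) vs)))"
  using assms(1)
proof (induction vs)
  case Nil
  then show ?case by simp
next
  case (Cons w vs)
  have "(\<Sum>j<k. (int (w j))\<^sup>2) = int r" "(\<Sum>j<k. (int (v j))\<^sup>2) = int r"
    using Cons.prems[of w] assms(2) by (auto simp flip: of_nat_power of_nat_sum)
  then have "(\<Sum>j<k. (int (w j) - int (v j))\<^sup>2) = 2 * int r - 2 * (\<Sum>j<k. int (v j) * int (w j))"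
    by (simp add: power2_diff sum.distrib sum_subtractf sum_distrib_left mult_ac)
  then show ?case
    using Cons by (simp add: sum.distrib algebra_simps)
qed

text \<open>With equal norms, the total squared distance to \<open>v\<close> depends only on the
  coordinate sums. When \<open>v\<close> is the mean it is \<open>2 * n * r - 2 * n * r = 0\<close>
  for \<open>n = length vs\<close>, so every term vanishes.\<close>

lemma sphere_average:
  fixes v :: "nat \<Rightarrow> nat"
  assumes "\<And>w. w \<in> set vs \<Longrightarrow> (\<Sum>j<k. (w j)\<^sup>2) = r" and "(\<Sum>j<k. (v j)\<^sup>2) = r"
    and "\<And>j. j < k \<Longrightarrow> sum_list (map (\<lambda>w. w j) vs) = length vs * v j"
    and "w \<in> set vs" "j < k"
  shows "w j = v j"
proof -
  have r: "(\<Sum>j<k. (int (v j))\<^sup>2) = int r"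
    using assms(2) by (auto simp flip: of_nat_power of_nat_sum)
  have "(\<Sum>j<k. int (v j) * int (sum_list (map (\<lambda>w. w j) vs))) =
      (\<Sum>j<k. int (length vs) * (int (v j))\<^sup>2)"
    using assms(3) by (intro sum.cong) (auto simp: power2_eq_square)
  also have "\<dots> = int (length vs) * int r"
    by (simp add: r flip: sum_distrib_left)
  finally have "sum_list (map (\<lambda>w. \<Sum>j<k. (int (w j) - int (v j))\<^sup>2) vs) = 0"
    using sum_list_sq_dist[OF assms(1,2), of vs] by simp
  then have "(\<Sum>j<k. (int (w j) - int (v j))\<^sup>2) = 0"
    using assms(4) by (subst (asm) sum_list_nonneg_eq_0_iff) (auto intro: sum_nonneg)
  then show ?thesis
    using assms(5) by (subst (asm) sum_nonneg_eq_0_iff) auto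
qed

text \<open>Behrend's construction: by strict convexity, no point of a sphere is a nontrivial average
  of points of the sphere; digits below \<open>d\<close> in base \<open>l * d\<close> make sums of \<open>l\<close> numbers carry-free.\<close>

lemma large_average_free:
  assumes "0 < k" "0 < d" "0 < l"
  obtains B where "B \<subseteq> {..<(l * d) ^ k}" "d ^ k \<le> card B * (k * d\<^sup>2)"
    "\<And>n. n \<le> l \<Longrightarrow> average_free n B"
proof -
  define V where "V = {..<k} \<rightarrow>\<^sub>E {..<d}"
  define S where "S r = {v \<in> V. (\<Sum>j<k. (v j)\<^sup>2) = r}" for r
  have finV: "finite V"
    unfolding V_def by (intro finite_PiE) auto
  have dlt: "v j < d" if "v \<in> V" "j < k" for v j
    using that unfolding V_def by (auto dest: PiE_mem)
  have norm: "(\<Sum>j<k. (v j)\<^sup>2) < k * d\<^sup>2" if "v \<in> V" for v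
  proof -
    have "(\<Sum>j<k. (v j)\<^sup>2) < (\<Sum>j<k. d\<^sup>2)"
      using assms dlt[OF that] by (intro sum_strict_mono) (auto intro: power_strict_mono)
    then show ?thesis by simp
  qed
  have "V = (\<Union>r<k * d\<^sup>2. S r)"
    using norm by (auto simp: S_def)
  then have "card V \<le> (\<Sum>r<k * d\<^sup>2. card (S r))"
    using card_UN_le[of "{..<k * d\<^sup>2}" S] by simp
  moreover have "card V = d ^ k"
    by (simp add: V_def card_PiE)
  ultimately have le: "d ^ k \<le> (\<Sum>r<k * d\<^sup>2. card (S r))"
    by simp
  \<comment> \<open>Pigeonhole: the squared norm takes at most \<open>k * d\<^sup>2\<close>
    values.\<close>
  have "\<exists>r. d ^ k \<le> card (S r) * (k * d\<^sup>2)"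
  proof (rule ccontr)
    assume "\<not> ?thesis"
    then have *: "card (S r) * (k * d\<^sup>2) < d ^ k" for r
      by (auto simp: not_le)
    have "(\<Sum>r<k * d\<^sup>2. card (S r)) * (k * d\<^sup>2) = (\<Sum>r<k * d\<^sup>2. card (S r) * (k * d\<^sup>2))"
      by (rule sum_distrib_right)
    also have "\<dots> < (\<Sum>r<k * d\<^sup>2. d ^ k)"
      using * assms by (intro sum_strict_mono) (simp_all add: lessThan_empty_iff)
    also have "\<dots> = d ^ k * (k * d\<^sup>2)"
      by simp
    finally show False
      using mult_le_mono1[OF le, of "k * d\<^sup>2"] by linarith
  qed
  then obtain r where r: "d ^ k \<le> card (S r) * (k * d\<^sup>2)" ..
  let ?Q = "l * d"
  define B where "B = digit_sum ?Q k ` S r"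
  have Slt: "v j < d" if "v \<in> S r" "j < k" for v j
    using that dlt by (auto simp: S_def)
  have "d \<le> ?Q"
    using assms by simp
  then have SQ: "v j < ?Q" if "v \<in> S r" "j < k" for v j
    using Slt[OF that] by linarith
  have "inj_on (digit_sum ?Q k) (S r)"
  proof (rule inj_onI)
    fix v w assume vw: "v \<in> S r" "w \<in> S r" "digit_sum ?Q k v = digit_sum ?Q k w"
    then have "v j = w j" if "j < k" for j
      using digit_sum_inj[OF vw(3)] SQ that by blast
    then show "v = w"
      using vw(1,2) by (intro PiE_ext[of v "{..<k}" "\<lambda>_. {..<d}"]) (auto simp: S_def V_def)
  qed
  then have cardB: "card B = card (S r)"
    unfolding B_def by (rule card_image)
  have "average_free n B" if n: "n \<le> l" for n
    unfolding average_free_def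
  proof (intro allI impI, elim conjE)
    fix bs b
    assume bs: "set bs \<subseteq> B" "length bs = n" "b \<in> B" "sum_list bs = n * b"
    obtain v where v: "v \<in> S r" "b = digit_sum ?Q k v"
      using bs(3) by (auto simp: B_def)
    have "bs \<in> map (digit_sum ?Q k) ` lists (S r)"
      using bs(1) by (auto simp: B_def simp flip: lists_image)
    then obtain vs where vs: "set vs \<subseteq> S r" "bs = map (digit_sum ?Q k) vs"
      by auto
    have len: "length vs = n"
      using bs(2) vs(2) by simp
    show "set bs \<subseteq> {b}"
    proof (cases "n = 0")
      case True
      then show ?thesis using bs by simp
    next
      case False
      have "n * v j < ?Q" if "j < k" for j
      proof -
        have "n * v j < n * d"
          using Slt[OF v(1) that] False by simp
        also have "\<dots> \<le> l * d"
          using n by simp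
        finally show ?thesis .
      qed
      moreover have "sum_list (map (\<lambda>w. w j) vs) < ?Q" if "j < k" for j
      proof -
        have "sum_list (map (\<lambda>w. w j) vs) \<le> sum_list (map (\<lambda>w. d - 1) vs)"
          using Slt vs(1) that by (intro sum_list_mono) fastforce
        also have "\<dots> = n * (d - 1)"
          using len by (simp add: sum_list_triv)
        also have "\<dots> < n * d"
          using False assms by simp
        also have "\<dots> \<le> l * d"
          using n by simp
        finally show ?thesis .
      qed
      moreover have "digit_sum ?Q k (\<lambda>j. sum_list (map (\<lambda>w. w j) vs)) = digit_sum ?Q k (\<lambda>j. n * v j)"
        using bs(4) unfolding vs(2) v(2) sum_list_digit_sum
        by (simp add: digit_sum_def sum_distrib_left mult_ac)
      \<comment> \<open>Both digit sequences stay below \<open>?Q\<close>, so no carries occur and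
        the equation of numbers splits into one equation per coordinate.\<close>
      ultimately have eq: "sum_list (map (\<lambda>w. w j) vs) = length vs * v j" if "j < k" for j
        using digit_sum_inj[of ?Q k "\<lambda>j. sum_list (map (\<lambda>w. w j) vs)" "\<lambda>j. n * v j" j] that len
        by simp
      have "digit_sum ?Q k w = digit_sum ?Q k v" if "w \<in> set vs" for w
      proof -
        have "w j = v j" if "j < k" for j
          by (rule sphere_average[of vs k r v, OF _ _ eq \<open>w \<in> set vs\<close> that])
            (use vs v in \<open>auto simp: S_def\<close>)
        then show ?thesis
          by (simp add: digit_sum_def)
      qed
      then show ?thesis
        using vs v by auto
    qed
  qed
  moreover have "B \<subseteq> {..<?Q ^ k}"
    using digit_sum_less SQ unfolding B_def by blast
  ultimately show thesis
    using r cardB by (intro that[of B]) auto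
qed

section \<open>Codes far from all orientations\<close>

text \<open>Union bound over \<open>z\<close> and a \<open>K\<close>-element set of agreements of \<open>c\<close> with \<open>W z\<close>.\<close>

lemma exists_code_avoiding:
  fixes W :: "'o \<Rightarrow> 'a \<Rightarrow> 'w"
  assumes fin: "finite A" "finite X" "finite Z" and X: "X \<noteq> {}"
    and W: "\<And>z a. z \<in> Z \<Longrightarrow> a \<in> A \<Longrightarrow> W z a \<in> X"
    and count: "card A ^ K * card Z < card X ^ K"
    and K: "K \<le> card A"
  obtains c where "\<And>a. a \<in> A \<Longrightarrow> c a \<in> X" "\<And>z. z \<in> Z \<Longrightarrow> card {a \<in> A. c a = W z a} < K"
proof -
  define F where "F = A \<rightarrow>\<^sub>E X"
  define T where "T = {S. S \<subseteq> A \<and> card S = K}"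
  \<comment> \<open>\<open>bad (z, S)\<close> consists of the codes that follow \<open>W z\<close>
    on all of \<open>S\<close>; the \<open>K\<close> prescribed positions leave
    \<open>card X ^ (card A - K)\<close> of them.\<close>
  define bad where "bad p = PiE A (\<lambda>a. if a \<in> snd p then {W (fst p) a} else X)" for p
  have finT: "finite T" and cardT: "card T \<le> card A ^ K"
    using fin n_subsets[OF fin(1), of K] binomial_le_pow[OF K] by (auto simp: T_def)
  have "card (bad p) = card X ^ (card A - K)" if "p \<in> Z \<times> T" for p
  proof -
    obtain S where S: "snd p = S" "S \<subseteq> A" "card S = K"
      using \<open>p \<in> Z \<times> T\<close> by (auto simp: T_def)
    then have "finite S"
      using fin finite_subset by blast
    have "card (bad p) = (\<Prod>a\<in>A. if a \<in> S then 1 else card X)"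
      unfolding bad_def S(1) card_PiE[OF fin(1)] by (intro prod.cong) auto
    also have "\<dots> = (\<Prod>a\<in>A - S. card X)"
      using fin by (intro prod.mono_neutral_cong_right) auto
    finally show ?thesis
      using S \<open>finite S\<close> by (simp add: card_Diff_subset)
  qed
  then have "card (\<Union>p\<in>Z \<times> T. bad p) \<le> card (Z \<times> T) * card X ^ (card A - K)"
    using card_UN_le[of "Z \<times> T" bad] fin finT by simp
  also have "\<dots> \<le> (card A ^ K * card Z) * card X ^ (card A - K)"
    using cardT by (simp add: card_cartesian_product)
  also have "\<dots> < card X ^ K * card X ^ (card A - K)"
  proof -
    have "0 < card X"
      using fin X by (simp add: card_gt_0_iff)
    then show ?thesis
      using count by simp
  qed
  also have "\<dots> = card F"
    using fin K by (simp add: F_def card_PiE flip: power_add)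
  finally have "card (\<Union>p\<in>Z \<times> T. bad p) < card F" .
  moreover have "finite (\<Union>p\<in>Z \<times> T. bad p)"
  proof (intro finite_UN_I)
    fix p assume "p \<in> Z \<times> T"
    show "finite (bad p)"
      unfolding bad_def using fin by (intro finite_PiE) auto
  qed (use fin finT in auto)
  ultimately have "\<not> F \<subseteq> (\<Union>p\<in>Z \<times> T. bad p)"
    by (meson card_mono not_le)
  then obtain c where c: "c \<in> F" "\<And>p. p \<in> Z \<times> T \<Longrightarrow> c \<notin> bad p"
    by blast
  show thesis
  proof
    show "c a \<in> X" if "a \<in> A" for a
      using c(1) that by (auto simp: F_def)
    show "card {a \<in> A. c a = W z a} < K" if z: "z \<in> Z" for z
    proof (rule ccontr)
      \<comment> \<open>Any \<open>K\<close> of the agreements form a set \<open>S\<close> that puts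
        \<open>c\<close> into \<open>bad (z, S)\<close>.\<close>
      assume "\<not> ?thesis"
      then obtain S where S: "S \<subseteq> {a \<in> A. c a = W z a}" "card S = K"
        by (meson obtain_subset_with_card_n not_less)
      then have "c \<in> bad (z, S)"
        using c(1) by (auto simp: bad_def F_def PiE_iff)
      moreover have "(z, S) \<in> Z \<times> T"
        using S z by (auto simp: T_def)
      ultimately show False
        using c(2) by blast
    qed
  qed
qed

section \<open>Two-cycles threaded by lines\<close>

text \<open>The low bit of the second component stores the port. Pairing is bijective, so every
  natural number, padding vertices included, has a level, a position and a port.\<close>

definition vertex :: "nat \<Rightarrow> nat \<Rightarrow> bool \<Rightarrow> nat" where
  "vertex i x p = prod_encode (i, 2 * x + of_bool p)"

definition level :: "nat \<Rightarrow> nat" where "level v = fst (prod_decode v)"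

definition pos :: "nat \<Rightarrow> nat" where "pos v = snd (prod_decode v) div 2"

definition port :: "nat \<Rightarrow> bool" where "port v = odd (snd (prod_decode v))"

lemma vertex_proj [simp]:
  "level (vertex i x p) = i" "pos (vertex i x p) = x" "port (vertex i x p) = p"
  by (auto simp: vertex_def level_def pos_def port_def)

lemma vertex_collapse [simp]: "vertex (level v) (pos v) (port v) = v"
proof -
  have "2 * pos v + of_bool (port v) = snd (prod_decode v)"
    by (auto simp: pos_def port_def)
  then show ?thesis
    by (simp add: vertex_def level_def)
qed

lemma vertex_eqI:
  assumes "level u = level v" "pos u = pos v" "port u = port v"
  shows "u = v"
proof -
  have "vertex (level u) (pos u) (port u) = vertex (level v) (pos v) (port v)"
    by (simp only: assms)
  then show ?thesis
    by (simp only: vertex_collapse)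
qed

lemma vertex_eq_iff [simp]: "vertex i x p = vertex j y q \<longleftrightarrow> i = j \<and> x = y \<and> p = q"
proof
  assume eq: "vertex i x p = vertex j y q"
  show "i = j \<and> x = y \<and> p = q"
    using arg_cong[OF eq, of level] arg_cong[OF eq, of pos] arg_cong[OF eq, of port] by simp
qed simp

text \<open>Position \<open>x\<close> at level \<open>i < l\<close> carries a two-cycle on the ports \<open>False\<close> and \<open>True\<close>.
  The line \<open>(a, b)\<close> passes the positions \<open>a + i * b\<close>, entering level \<open>i\<close> at port \<open>c (a, b) i\<close>
  and leaving it at the other port.\<close>

locale line_graph =
  fixes l M :: nat and B :: "nat set" and c :: "nat \<times> nat \<Rightarrow> nat \<Rightarrow> bool" and V :: "nat set"
  assumes l: "0 < l"
    and B: "B \<subseteq> {..<M}" "average_free (l - 1) B"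
    and V: "finite V" "\<And>i x p. i < l \<Longrightarrow> x < l * M \<Longrightarrow> vertex i x p \<in> V"
begin

abbreviation lines :: "(nat \<times> nat) set" where
  "lines \<equiv> {..<M} \<times> B"

definition entry :: "nat \<times> nat \<Rightarrow> nat \<Rightarrow> nat" where
  "entry ab i = vertex i (fst ab + i * snd ab) (c ab i)"

definition leave :: "nat \<times> nat \<Rightarrow> nat \<Rightarrow> nat" where
  "leave ab i = vertex i (fst ab + i * snd ab) (\<not> c ab i)"

definition cycle_arcs :: "(nat \<times> nat) set" where
  "cycle_arcs = {(vertex i x p, vertex i x (\<not> p)) |i x p. i < l \<and> x < l * M}"

definition line_arcs :: "(nat \<times> nat) set" where
  "line_arcs = {(leave ab i, entry ab (Suc i)) |ab i. ab \<in> lines \<and> Suc i < l}"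

text \<open>\<open>V\<close> may contain more than the ports of the grid; the surplus vertices are
  isolated and adjust the vertex count.\<close>

definition G :: "nat pair_pre_digraph" where
  "G = \<lparr>pverts = V, parcs = cycle_arcs \<union> line_arcs\<rparr>"

text \<open>Ports are ignored, so both ends of a two-cycle lie on the same lines.\<close>

definition on_line :: "nat \<times> nat \<Rightarrow> nat \<Rightarrow> bool" where
  "on_line ab v \<longleftrightarrow> pos v = fst ab + level v * snd ab"

lemma G_simps [simp]: "pverts G = V" "parcs G = cycle_arcs \<union> line_arcs"
  by (simp_all add: G_def)

text \<open>This is why a level has \<open>l * M\<close> positions: at most \<open>l - 1\<close>
  slopes below \<open>M\<close> are added to a start below \<open>M\<close>.\<close>

lemma pos_bound:
  assumes "ab \<in> lines" "i < l"
  shows "fst ab + i * snd ab < l * M"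
proof -
  have "fst ab < M" "snd ab < M"
    using assms B by auto
  then have "fst ab + i * snd ab < M + i * M"
    by (intro add_less_le_mono) auto
  also have "\<dots> = Suc i * M" by simp
  also have "\<dots> \<le> l * M"
    using assms(2) by (intro mult_le_mono1) auto
  finally show ?thesis .
qed

lemma entry_leave_in_V:
  assumes "ab \<in> lines" "i < l"
  shows "entry ab i \<in> V" "leave ab i \<in> V"
  using V(2)[OF assms(2) pos_bound[OF assms]] by (auto simp: entry_def leave_def)

lemma entry_leave_in_cycle_arcs:
  assumes "ab \<in> lines" "i < l"
  shows "(entry ab i, leave ab i) \<in> cycle_arcs"
  using pos_bound[OF assms] assms unfolding entry_def leave_def cycle_arcs_def by blast

lemma arcs_subset: "parcs G \<subseteq> V \<times> V"
  by (auto simp: cycle_arcs_def line_arcs_def V entry_leave_in_V)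

lemma pair_digraph_G: "pair_digraph G"
proof
  show "finite (parcs G)"
    using arcs_subset V(1) by (meson finite_SigmaI finite_subset)
  show "fst e \<noteq> snd e" if "e \<in> parcs G" for e
    using that by (auto simp: cycle_arcs_def line_arcs_def entry_def leave_def)
  show "fst e \<in> pverts G" "snd e \<in> pverts G" if "e \<in> parcs G" for e
    using that arcs_subset by auto
qed (use V in auto)

section \<open>Paths and the slopes they collect\<close>

lemma arc_cases:
  assumes "(u, v) \<in> parcs G"
  obtains "level v = level u" "pos v = pos u"
    | b where "b \<in> B" "level v = Suc (level u)" "pos v = pos u + b"
  using assms by (auto simp: cycle_arcs_def line_arcs_def entry_def leave_def)

text \<open>Two-cycle arcs change neither level nor position, and a line arc advances one level and
  adds its slope; \<open>bs\<close> collects these slopes, latest first.\<close>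

lemma reachable_slopes:
  assumes "reachable (with_proj G) u v"
  shows "\<exists>bs. set bs \<subseteq> B \<and> level v = level u + length bs \<and> pos v = pos u + sum_list bs"
  using assms unfolding reachable_def
proof (induction rule: rtrancl_on_induct)
  case base
  show ?case by (intro exI[of _ "[]"]) auto
next
  case (step y z)
  then obtain bs where bs: "set bs \<subseteq> B" "level y = level u + length bs" "pos y = pos u + sum_list bs"
    by blast
  have "(y, z) \<in> parcs G"
    using step by simp
  then show ?case
  proof (cases rule: arc_cases)
    case 1
    then show ?thesis
      using bs by (intro exI[of _ bs]) simp
  next
    case (2 b)
    then show ?thesis
      using bs by (intro exI[of _ "b # bs"]) simp
  qed
qed

lemma reachable_level: "reachable (with_proj G) u v \<Longrightarrow> level u \<le> level v"
  using reachable_slopes by fastforce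

text \<open>The slopes before and after \<open>u\<close> form a list of \<open>l - 1\<close>
  elements of \<open>B\<close> with mean \<open>snd ab\<close>. Average-freeness makes them all
  equal to \<open>snd ab\<close>, so the path up to \<open>u\<close> stays on the line.\<close>

lemma unique_line:
  assumes ab: "ab \<in> lines"
    and "reachable (with_proj G) (entry ab 0) u" "reachable (with_proj G) u (leave ab (l - 1))"
  shows "on_line ab u" "level u < l"
proof -
  obtain bs where bs: "set bs \<subseteq> B" "level u = length bs" "pos u = fst ab + sum_list bs"
    using reachable_slopes[OF assms(2)] by (auto simp: entry_def)
  obtain bs' where bs': "set bs' \<subseteq> B" "l - 1 = level u + length bs'"
      "fst ab + (l - 1) * snd ab = pos u + sum_list bs'"
    using reachable_slopes[OF assms(3)] by (auto simp: leave_def)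
  have "set (bs @ bs') \<subseteq> {snd ab}"
  proof -
    have "set (bs @ bs') \<subseteq> B \<and> length (bs @ bs') = l - 1 \<and> snd ab \<in> B \<and>
        sum_list (bs @ bs') = (l - 1) * snd ab"
      using bs bs' ab by auto
    then show ?thesis
      using B(2) unfolding average_free_def by blast
  qed
  then have "bs = replicate (length bs) (snd ab)"
    by (intro replicate_eqI) auto
  then have "sum_list bs = length bs * snd ab"
    by (metis sum_list_replicate of_nat_id)
  then show "on_line ab u"
    using bs by (simp add: on_line_def)
  show "level u < l"
    using bs' l by linarith
qed

lemma line_reachable:
  assumes ab: "ab \<in> lines"
  shows "reachable (with_proj G) (entry ab 0) (leave ab (l - 1))"
proof -
  interpret pair_digraph G by (rule pair_digraph_G)
  have step: "reachable (with_proj G) (entry ab i) (leave ab i)" if "i < l" for i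
    using entry_leave_in_cycle_arcs[OF ab that] by (intro reachable_adjI) simp
  have "reachable (with_proj G) (entry ab 0) (leave ab i)" if "i < l" for i
    using that
  proof (induction i)
    case 0
    then show ?case using step by simp
  next
    case (Suc i)
    then have "(leave ab i, entry ab (Suc i)) \<in> parcs G"
      using ab by (auto simp: line_arcs_def)
    then have "reachable (with_proj G) (leave ab i) (entry ab (Suc i))"
      by (intro reachable_adjI) simp
    then show ?case
      using Suc step[of "Suc i"] by (meson reachable_trans Suc_lessD)
  qed
  then show ?thesis
    using l by simp
qed

text \<open>Two positions at different levels determine the line through them, so an additional arc
  between different levels serves a single line.\<close>

definition hit :: "(nat \<times> nat) set \<Rightarrow> (nat \<times> nat) set" where
  "hit F = {ab \<in> lines. \<exists>(u, v) \<in> F. level u < level v \<and> on_line ab u \<and> on_line ab v}"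

lemma card_hit:
  assumes "finite F"
  shows "card (hit F) \<le> card F"
proof -
  \<comment> \<open>For two points on a common line the division is exact, and slope and intercept
    are recovered from the points.\<close>
  define slope where "slope u v = (pos v - pos u) div (level v - level u)" for u v
  have "ab = (pos u - level u * slope u v, slope u v)"
    if "level u < level v" "on_line ab u" "on_line ab v" for ab u v
  proof -
    have "pos v - pos u = (level v - level u) * snd ab"
      using that by (simp add: on_line_def diff_mult_distrib)
    then have "slope u v = snd ab"
      using that(1) by (simp add: slope_def)
    then show ?thesis
      using that(2) by (simp add: on_line_def prod_eq_iff)
  qed
  then have "hit F \<subseteq> (\<lambda>(u, v). (pos u - level u * slope u v, slope u v)) ` F"
    unfolding hit_def by fast
  then show ?thesis
    using surj_card_le assms by blast
qed

text \<open>A path of \<open>D\<close> along a line that no additional arc serves must use the two-cycle at every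
  level, in the direction prescribed by the line.\<close>

lemma unhit_line_arcs:
  assumes ab: "ab \<in> lines" and nohit: "ab \<notin> hit F"
    and sub: "parcs D - parcs G \<subseteq> F" and verts: "pverts D = V"
    and sound: "\<And>u v. reachable (with_proj D) u v \<Longrightarrow> reachable (with_proj G) u v"
    and D: "pair_fin_digraph D"
    and path: "reachable (with_proj D) (entry ab 0) (leave ab (l - 1))"
    and i: "i < l"
  shows "(entry ab i, leave ab i) \<in> parcs D"
proof -
  interpret pair_fin_digraph D by (rule D)
  let ?s = "entry ab 0" and ?t = "leave ab (l - 1)"
  have on: "on_line ab u" "level u < l"
    if "reachable (with_proj D) ?s u" "reachable (with_proj D) u ?t" for u
    using unique_line[OF ab] sound that by blast+
  \<comment> \<open>Invariant along the path: all lower levels have been crossed in the prescribed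
    direction, and at the current level \<open>u\<close> is still the entry port or the crossing arc
    is already known to be in \<open>D\<close>.\<close>
  have "(\<forall>i<level u. (entry ab i, leave ab i) \<in> parcs D) \<and>
      (port u = c ab (level u) \<or> (entry ab (level u), leave ab (level u)) \<in> parcs D)"
    if "reachable (with_proj D) ?s u" "reachable (with_proj D) u ?t" for u
    using that(1)[unfolded reachable_def] that(2)
  proof (induction rule: rtrancl_on_induct)
    case base
    then show ?case by (simp add: entry_def)
  next
    case (step u v)
    have arc: "(u, v) \<in> parcs D"
      using step by simp
    then have uv: "reachable (with_proj D) u v"
      by (intro reachable_adjI) simp
    have su: "reachable (with_proj D) ?s u"
      using step by (simp add: reachable_def)
    have sv: "reachable (with_proj D) ?s v"
      using su uv by (rule reachable_trans)
    have ut: "reachable (with_proj D) u ?t"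
      using uv step.prems by (rule reachable_trans)
    note IH = step.IH[OF ut]
    note onu = on[OF su ut] and onv = on[OF sv step.prems]
    have "level u \<le> level v"
      using reachable_level sound uv by blast
    then consider "level u = level v" | "level u < level v"
      by linarith
    then show ?case
    proof cases
      case 1
      then have "pos u = pos v"
        using onu onv by (simp add: on_line_def)
      \<comment> \<open>Within a level, passing from the entry port to the other port is exactly the
        prescribed arc.\<close>
      have "(entry ab (level u), leave ab (level u)) \<in> parcs D"
        if "port u = c ab (level u)" "port v \<noteq> c ab (level u)"
      proof -
        have "entry ab (level u) = u"
          using that onu by - (rule vertex_eqI, simp_all add: entry_def on_line_def)
        moreover have "leave ab (level u) = v"
          using that 1 onv by - (rule vertex_eqI, simp_all add: leave_def on_line_def)
        ultimately show ?thesis using arc by simp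
      qed
      then show ?thesis
        using IH 1 by auto
    next
      case 2
      then have "(u, v) \<notin> F"
        using nohit ab onu onv by (auto simp: hit_def)
      then have "(u, v) \<in> parcs G"
        using arc sub by blast
      then have "(u, v) \<in> line_arcs"
        using 2 by (auto simp: cycle_arcs_def)
      then obtain cd i where cd: "u = leave cd i" "v = entry cd (Suc i)"
        by (auto simp: line_arcs_def)
      \<comment> \<open>Two consecutive points determine the line, so the arc belongs to
        \<open>ab\<close> itself and joins its leaving port to its next entry port.\<close>
      have eq: "fst cd + i * snd cd = fst ab + i * snd ab"
        using onu(1) by (simp add: cd on_line_def leave_def)
      moreover have "fst cd + i * snd cd + snd cd = fst ab + i * snd ab + snd ab"
        using onv(1) by (simp add: cd on_line_def entry_def)
      ultimately have "snd cd = snd ab"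
        by linarith
      with eq have "cd = ab"
        by (simp add: prod_eq_iff)
      then have "port u \<noteq> c ab (level u)" "port v = c ab (level v)" "level v = Suc (level u)"
        by (auto simp: cd entry_def leave_def)
      then show ?thesis
        using IH by (auto simp: less_Suc_eq)
    qed
  qed
  \<comment> \<open>At \<open>u = ?t\<close> the port is the leaving one, so the second alternative
    of the invariant yields the last level.\<close>
  from this[OF path] have "(\<forall>i<l - 1. (entry ab i, leave ab i) \<in> parcs D) \<and>
      (entry ab (l - 1), leave ab (l - 1)) \<in> parcs D"
    using path reachable_in_verts by (simp add: leave_def)
  then show ?thesis
    using i by (cases "i = l - 1") auto
qed

text \<open>\<open>Z\<close> encodes an orientation: a two-cycle in \<open>Z\<close> is traversed
  from port \<open>False\<close> to port \<open>True\<close>, any other from \<open>True\<close> to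
  \<open>False\<close>.\<close>

definition agrees :: "(nat \<times> nat) set \<Rightarrow> (nat \<times> nat) set" where
  "agrees Z = {ab \<in> lines. \<forall>i<l. c ab i \<longleftrightarrow> (i, fst ab + i * snd ab) \<notin> Z}"

text \<open>At most \<open>f\<close> lines are hit by additional arcs. Every other line is realised
  in a single DAG and agrees with the orientation \<open>Z j\<close> read off from it, which leaves
  at most \<open>K\<close> lines per DAG.\<close>

lemma cover_bound:
  assumes cover: "dag_cover G f g D" and pres: "reachability_preserving G g D"
    and agree: "\<And>Z. Z \<subseteq> {..<l} \<times> {..<l * M} \<Longrightarrow> card (agrees Z) \<le> K"
  shows "card lines \<le> f + g * K"
proof -
  define F where "F = (\<Union>i\<in>{1..g}. parcs (D i)) - parcs G"
  define Z where "Z j = {(i, x). i < l \<and> x < l * M \<and>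
    (vertex i x False, vertex i x True) \<in> parcs (D j)}" for j
  have fin: "pair_fin_digraph (D j)" and acyc: "acyclic (parcs (D j))" and verts: "pverts (D j) = V"
    if "j \<in> {1..g}" for j
    using cover that by (auto simp: dag_cover_def dag_def)
  have finF: "finite F"
    unfolding F_def using fin pair_fin_digraph.pair_finite_arcs by blast
  have finL: "finite lines"
    using B(1) finite_subset by blast
  have "ab \<in> (\<Union>j\<in>{1..g}. agrees (Z j))" if ab: "ab \<in> lines" and nohit: "ab \<notin> hit F" for ab
  proof -
    have "entry ab 0 \<in> V" "leave ab (l - 1) \<in> V"
      using entry_leave_in_V[OF ab] l by auto
    then obtain j where j: "j \<in> {1..g}"
      and path: "reachable (with_proj (D j)) (entry ab 0) (leave ab (l - 1))"
      using line_reachable[OF ab] pres unfolding reachability_preserving_def by auto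
    have sound: "reachable (with_proj G) u v" if "reachable (with_proj (D j)) u v" for u v
    proof -
      have "u \<in> V" "v \<in> V"
        using that verts[OF j] unfolding reachable_def by (auto dest: in_rtrancl_on_in_F)
      then show ?thesis
        using that j pres unfolding reachability_preserving_def by auto
    qed
    have arc: "(entry ab i, leave ab i) \<in> parcs (D j)" if "i < l" for i
      by (rule unhit_line_arcs[OF ab nohit _ verts[OF j] sound fin[OF j] path that])
        (use j in \<open>auto simp: F_def\<close>)
    have "c ab i \<longleftrightarrow> (i, fst ab + i * snd ab) \<notin> Z j" if i: "i < l" for i
    proof (cases "c ab i")
      case True
      then have "(vertex i (fst ab + i * snd ab) True, vertex i (fst ab + i * snd ab) False)
          \<in> parcs (D j)"
        using arc[OF i] by (simp add: entry_def leave_def)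
      \<comment> \<open>Acyclicity excludes having both arcs of a two-cycle.\<close>
      then have "(vertex i (fst ab + i * snd ab) False, vertex i (fst ab + i * snd ab) True)
          \<notin> parcs (D j)"
        using acyc[OF j] unfolding acyclic_def by (meson r_into_trancl trancl_into_trancl)
      then show ?thesis
        using True by (simp add: Z_def)
    next
      case False
      then show ?thesis
        using arc[OF i] pos_bound[OF ab i] i by (simp add: Z_def entry_def leave_def)
    qed
    then show ?thesis
      using ab j by (auto simp: agrees_def)
  qed
  then have "lines \<subseteq> hit F \<union> (\<Union>j\<in>{1..g}. agrees (Z j))"
    by blast
  then have "card lines \<le> card (hit F \<union> (\<Union>j\<in>{1..g}. agrees (Z j)))"
    using finL by (intro card_mono) (auto simp: hit_def agrees_def)
  also have "\<dots> \<le> card (hit F) + card (\<Union>j\<in>{1..g}. agrees (Z j))"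
    by (rule card_Un_le)
  also have "\<dots> \<le> card (hit F) + (\<Sum>j\<in>{1..g}. card (agrees (Z j)))"
    by (simp add: card_UN_le)
  also have "\<dots> \<le> f + (\<Sum>j\<in>{1..g}. K)"
  proof (intro add_mono sum_mono agree)
    show "card (hit F) \<le> f"
      using card_hit[OF finF] cover unfolding dag_cover_def F_def by linarith
  qed (auto simp: Z_def)
  finally show ?thesis
    by simp
qed

end

section \<open>Choice of parameters\<close>

lemma finite_superset_card:
  assumes "finite I" "card I \<le> n"
  obtains V :: "nat set" where "I \<subseteq> V" "finite V" "card V = n"
proof -
  have "n \<le> card (I \<union> {..<n})"
    using card_mono[of "I \<union> {..<n}" "{..<n}"] assms by simp
  then obtain V where "I \<subseteq> V" "V \<subseteq> I \<union> {..<n}" "card V = n"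
    using exists_subset_between[of I n "I \<union> {..<n}"] assms by auto
  then show thesis
    using assms by (intro that) (auto intro: finite_subset)
qed

text \<open>There are \<open>2 ^ (l * (l * M))\<close> orientations and \<open>2 ^ l\<close> words
  per line. Since the number of lines is at most \<open>2 ^ (l / 2)\<close>, the union bound
  succeeds just above \<open>2 * l * M\<close> agreements.\<close>

lemma exists_line_code:
  assumes l: "0 < l" and B: "B \<subseteq> {..<M}" and big: "(M * card B)\<^sup>2 \<le> 2 ^ l"
  obtains c where "\<And>Z. Z \<subseteq> {..<l} \<times> {..<l * M} \<Longrightarrow>
    card {ab \<in> {..<M} \<times> B. \<forall>i<l. c ab i \<longleftrightarrow> (i, fst ab + i * snd ab) \<notin> Z} \<le> 2 * l * M"
proof (cases "M * card B \<le> 2 * l * M")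
  \<comment> \<open>With so few lines any code works; otherwise \<open>?K\<close> is at most the
    number of lines, as the union bound requires.\<close>
  case True
  have "finite ({..<M} \<times> B)"
    using B finite_subset by blast
  then have "card {ab \<in> {..<M} \<times> B. Q ab} \<le> 2 * l * M" for Q
    by (rule order_trans[OF card_mono[of "{..<M} \<times> B"]])
      (use True in \<open>simp_all only: card_cartesian_product card_lessThan, auto\<close>)
  then show thesis
    by (rule that)
next
  case False
  \<comment> \<open>The \<open>+ 1\<close> makes \<open>l * ?K\<close> exceed
    \<open>2 * l * (l * M)\<close> by \<open>l\<close>, so the count is strict. The estimate is
    squared to avoid the exponent \<open>l / 2\<close>.\<close>
  let ?A = "{..<M} \<times> B" and ?K = "2 * l * M + 1" and ?Z = "Pow ({..<l} \<times> {..<l * M})"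
  \<comment> \<open>Words are sets of levels: \<open>i \<in> C ab\<close> will serve as
    \<open>c ab i\<close>.\<close>
  define W where "W Z ab = {i. i < l \<and> (i, fst ab + i * snd ab) \<notin> Z}" for Z and ab :: "nat \<times> nat"
  have card: "card ?A = M * card B" "card ?Z = 2 ^ (l * (l * M))" "card (Pow {..<l}) = 2 ^ l"
    by (simp_all add: card_cartesian_product card_Pow)
  have "((M * card B) ^ ?K * 2 ^ (l * (l * M)))\<^sup>2 = ((M * card B)\<^sup>2) ^ ?K * 2 ^ (2 * l * (l * M))"
    by (simp add: power_mult_distrib mult_ac flip: power_mult)
  also have "\<dots> \<le> (2 ^ l) ^ ?K * 2 ^ (2 * l * (l * M))"
    using big by (intro mult_le_mono1 power_mono) auto
  also have "\<dots> = 2 ^ (l * ?K + 2 * l * (l * M))"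
    by (simp only: power_add power_mult)
  also have "\<dots> < 2 ^ (2 * (l * ?K))"
    using l by (intro power_strict_increasing) (auto simp: algebra_simps)
  also have "\<dots> = (((2::nat) ^ l) ^ ?K)\<^sup>2"
    by (simp only: mult.commute[of 2] power_mult)
  finally have "(M * card B) ^ ?K * 2 ^ (l * (l * M)) < ((2::nat) ^ l) ^ ?K"
    by (rule power2_less_imp_less) simp
  then have "card ?A ^ ?K * card ?Z < card (Pow {..<l}) ^ ?K"
    by (simp only: card)
  moreover have "finite ?A"
    using B finite_subset by blast
  moreover have "?K \<le> card ?A"
    unfolding card(1) using False by linarith
  ultimately obtain C where C: "\<And>ab. ab \<in> ?A \<Longrightarrow> C ab \<in> Pow {..<l}"
      "\<And>Z. Z \<in> ?Z \<Longrightarrow> card {ab \<in> ?A. C ab = W Z ab} < ?K"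
    using exists_code_avoiding[of ?A "Pow {..<l}" ?Z W ?K] by (auto simp: W_def)
  show thesis
  proof (rule that)
    fix Z assume Z: "Z \<subseteq> {..<l} \<times> {..<l * M}"
    have "{ab \<in> ?A. \<forall>i<l. i \<in> C ab \<longleftrightarrow> (i, fst ab + i * snd ab) \<notin> Z} = {ab \<in> ?A. C ab = W Z ab}"
      using C(1) by (auto simp: W_def)
    then show "card {ab \<in> ?A. \<forall>i<l. i \<in> C ab \<longleftrightarrow> (i, fst ab + i * snd ab) \<notin> Z} \<le> 2 * l * M"
      using C(2)[of Z] Z by simp
  qed
qed

lemma exists_hard_graph:
  assumes l: "0 < l" and B: "B \<subseteq> {..<M}" "average_free (l - 1) B"
    and big: "(M * card B)\<^sup>2 \<le> 2 ^ l" and n: "2 * l\<^sup>2 * M \<le> n"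
  obtains G :: "nat pair_pre_digraph" where "pair_digraph G" "card (pverts G) = n"
    "\<And>f g D. dag_cover G f g D \<Longrightarrow> reachability_preserving G g D \<Longrightarrow>
      M * card B \<le> f + g * (2 * l * M)"
proof -
  obtain c where c: "\<And>Z. Z \<subseteq> {..<l} \<times> {..<l * M} \<Longrightarrow>
      card {ab \<in> {..<M} \<times> B. \<forall>i<l. c ab i \<longleftrightarrow> (i, fst ab + i * snd ab) \<notin> Z} \<le> 2 * l * M"
    using exists_line_code[OF l B(1) big] by blast
  \<comment> \<open>\<open>l\<close> levels, \<open>l * M\<close> positions and two ports; the rest
    of the \<open>n\<close> vertices is padding.\<close>
  let ?P = "{..<l} \<times> {..<l * M} \<times> (UNIV :: bool set)"
  define I where "I = (\<lambda>(i, x, p). vertex i x p) ` ?P"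
  have "card I \<le> card ?P"
    unfolding I_def by (rule card_image_le) simp
  also have "\<dots> = 2 * l\<^sup>2 * M"
    by (simp add: card_cartesian_product power2_eq_square)
  finally obtain V where V: "I \<subseteq> V" "finite V" and card_V: "card V = n"
    using finite_superset_card[of I n] n by (auto simp: I_def)
  have "vertex i x p \<in> V" if "i < l" "x < l * M" for i x p
    using V(1) that unfolding I_def by force
  then interpret line_graph l M B c V
    by unfold_locales (use l B V(2) in auto)
  show thesis
  proof (rule that[of G])
    show "M * card B \<le> f + g * (2 * l * M)"
      if "dag_cover G f g D" "reachability_preserving G g D" for f g D
      using cover_bound[OF that, of "2 * l * M"] c
      by (simp add: agrees_def card_cartesian_product)
  qed (use pair_digraph_G card_V in auto)
qed

text \<open>One \<open>\<eta>\<close> serves both exponents, so the final rates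
  \<open>\<epsilon>\<close> and \<open>\<delta>\<close> coincide.\<close>

definition hard :: "nat \<Rightarrow> real \<Rightarrow> nat pair_pre_digraph \<Rightarrow> bool" where
  "hard n \<eta> G \<longleftrightarrow> pair_digraph G \<and> card (pverts G) = n \<and>
    (\<forall>f g D. dag_cover G f g D \<and> reachability_preserving G g D \<and> real f \<le> real n powr (2 - \<eta>)
      \<longrightarrow> real g \<ge> real n powr (1 - \<eta>))"

text \<open>At rate 1 the claim for \<open>n > 0\<close> is only that some DAG exists, which
  reflexive reachability forces. This is the fallback for small \<open>n\<close>.\<close>

lemma hard_1: "hard n 1 \<lparr>pverts = {..<n}, parcs = {}\<rparr>"
proof -
  let ?G = "\<lparr>pverts = {..<n}, parcs = {}\<rparr> :: nat pair_pre_digraph"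
  have "real n powr 0 \<le> real g" if "reachability_preserving ?G g D" for g D
  \<comment> \<open>For \<open>n = 0\<close> the left side is \<open>0\<close>, because
    \<open>0 powr 0 = 0\<close>.\<close>
  proof (cases "n = 0")
    case False
    then have "reachable (with_proj ?G) 0 0"
      by (simp add: reachable_def)
    then have "\<exists>i\<in>{1..g}. reachable (with_proj (D i)) 0 0"
      using that False by (auto simp: reachability_preserving_def)
    then show ?thesis by auto
  qed simp
  then show ?thesis
    by (auto simp: hard_def intro!: pair_digraph.intro pair_fin_digraph.intro
        pair_wf_digraph.intro pair_fin_digraph_axioms.intro pair_loopfree_digraph.intro
        pair_loopfree_digraph_axioms.intro)
qed

text \<open>Both the number of vertices and the number of lines per vertex are
  \<open>2 ^ (k\<^sup>2 + o(k\<^sup>2))\<close>.\<close>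

definition param_M :: "nat \<Rightarrow> nat" where "param_M k = (k ^ 3 * 2 ^ k) ^ k"

definition graph_size :: "nat \<Rightarrow> nat" where "graph_size k = 2 * (k ^ 3)\<^sup>2 * param_M k"

text \<open>A lower bound for \<open>M * card B\<close>, from Behrend's
  \<open>d ^ k / (k * d\<^sup>2)\<close> slopes with \<open>d = 2 ^ k\<close>.\<close>

definition num_lines :: "nat \<Rightarrow> real" where
  "num_lines k = real (param_M k) * 2 ^ (k\<^sup>2) / (k * 4 ^ k)"

text \<open>The choice of \<open>k ^ 3\<close> levels: the left side is at most
  \<open>2 ^ (16 * k\<^sup>2)\<close>, and a cubic exponent dominates this from
  \<open>k = 16\<close> on.\<close>

lemma param_M_bound:
  assumes "16 \<le> k"
  shows "(param_M k * param_M k)\<^sup>2 \<le> 2 ^ (k ^ 3)"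
proof -
  have "k ^ 3 * 2 ^ k \<le> (2 ^ k) ^ 3 * (2::nat) ^ k"
    by (intro mult_le_mono1 power_mono) (auto intro: less_imp_le less_exp)
  also have "\<dots> = 2 ^ (4 * k)"
    by (simp flip: power_mult power_add)
  finally have "param_M k \<le> (2 ^ (4 * k)) ^ k"
    unfolding param_M_def by (rule power_mono) simp
  then have "param_M k ^ 4 \<le> ((2 ^ (4 * k)) ^ k) ^ 4"
    by (rule power_mono) simp
  also have "\<dots> = 2 ^ (16 * k\<^sup>2)"
    by (simp add: power2_eq_square mult_ac flip: power_mult)
  also have "\<dots> \<le> 2 ^ (k ^ 3)"
    using assms by (intro power_increasing) (auto simp: power2_eq_square power3_eq_cube)
  finally show ?thesis
    by (simp add: power2_eq_square power4_eq_xxxx mult_ac)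
qed

lemma exists_hard_graph_param:
  assumes k: "16 \<le> k" and n: "graph_size k \<le> n"
  obtains G :: "nat pair_pre_digraph" where "pair_digraph G" "card (pverts G) = n"
    "\<And>f g D. dag_cover G f g D \<Longrightarrow> reachability_preserving G g D \<Longrightarrow>
      num_lines k \<le> real f + real g * (2 * k ^ 3 * param_M k)"
proof -
  let ?l = "k ^ 3" and ?M = "param_M k"
  \<comment> \<open>Digits below \<open>2 ^ k\<close> in base \<open>k ^ 3 * 2 ^ k\<close>, which
    makes \<open>param_M k\<close> the bound on the slopes.\<close>
  obtain B where B: "B \<subseteq> {..<?M}" "(2 ^ k) ^ k \<le> card B * (k * (2 ^ k)\<^sup>2)"
      "\<And>n. n \<le> ?l \<Longrightarrow> average_free n B"
    using large_average_free[of k "2 ^ k" ?l] k unfolding param_M_def by auto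
  have "card B \<le> ?M"
    using card_mono[OF _ B(1)] by simp
  then have "(?M * card B)\<^sup>2 \<le> (?M * ?M)\<^sup>2"
    by (intro power_mono) auto
  also have "\<dots> \<le> 2 ^ ?l"
    using param_M_bound[OF k] .
  finally have big: "(?M * card B)\<^sup>2 \<le> 2 ^ ?l" .
  obtain G :: "nat pair_pre_digraph" where G: "pair_digraph G" "card (pverts G) = n"
    "\<And>f g D. dag_cover G f g D \<Longrightarrow> reachability_preserving G g D \<Longrightarrow>
      ?M * card B \<le> f + g * (2 * ?l * ?M)"
    using exists_hard_graph[of ?l B ?M n] B big n k unfolding graph_size_def by auto
  have "real ((2 ^ k) ^ k) \<le> real (card B * (k * (2 ^ k)\<^sup>2))"
    using B(2) by (simp only: of_nat_le_iff)
  then have "2 ^ (k\<^sup>2) \<le> real (card B) * (k * 4 ^ k)"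
    by (simp add: power2_eq_square flip: power_mult power_mult_distrib)
  then have "2 ^ (k\<^sup>2) / (k * 4 ^ k) \<le> real (card B)"
    using k by (simp add: divide_le_eq)
  then have "real ?M * (2 ^ (k\<^sup>2) / (k * 4 ^ k)) \<le> real ?M * real (card B)"
    by (intro mult_left_mono) auto
  then have lines: "num_lines k \<le> real (?M * card B)"
    by (simp add: num_lines_def)
  show thesis
  proof (rule that[OF G(1,2)])
    fix f g D assume "dag_cover G f g D" "reachability_preserving G g D"
    then have "real (?M * card B) \<le> real (f + g * (2 * ?l * ?M))"
      using G(3) by (simp only: of_nat_le_iff)
    then show "num_lines k \<le> real f + real g * (2 * k ^ 3 * param_M k)"
      using lines by simp
  qed
qed

section \<open>Asymptotics of the size and of the number of lines\<close>

lemma ln_param_M: "0 < k \<Longrightarrow> ln (real (param_M k)) = k * (3 * ln k + k * ln 2)"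
  by (simp add: param_M_def ln_realpow ln_mult)

lemma ln_graph_size:
  "0 < k \<Longrightarrow> ln (real (graph_size k)) = ln 2 + 6 * ln k + k * (3 * ln k + k * ln 2)"
  by (simp add: graph_size_def ln_mult ln_realpow ln_param_M param_M_def del: of_nat_power
      flip: power_mult) (simp add: ln_realpow ln_mult)

lemma param_M_pos: "0 < k \<Longrightarrow> 0 < param_M k"
  by (simp add: param_M_def)

lemma ln_num_lines:
  assumes "0 < k"
  shows "ln (num_lines k) = k * (3 * ln k + k * ln 2) + k\<^sup>2 * ln 2 - (ln k + k * ln 4)"
  using assms param_M_pos[OF assms]
  by (simp add: num_lines_def ln_div ln_mult ln_realpow ln_param_M)

text \<open>The logarithm of the size is asymptotic to \<open>k\<^sup>2 * ln 2\<close>, that of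
  \<open>num_lines\<close> to twice this. The size is taken at \<open>Suc k\<close> because
  \<open>n\<close> will lie between consecutive sizes; this does not change the leading
  term.\<close>

lemma eventually_graph_size_powr:
  assumes "0 < \<eta>"
  shows "\<forall>\<^sub>F k in at_top. real (graph_size (Suc k)) powr (2 - \<eta>) \<le> num_lines k / 2"
    and "\<forall>\<^sub>F k in at_top. real (graph_size (Suc k)) powr (1 - \<eta>) \<le>
      num_lines k / (4 * k ^ 3 * param_M k)"
proof -
  \<comment> \<open>\<open>S\<close> and \<open>P\<close> are closed forms of
    \<open>ln (graph_size (Suc k))\<close> and \<open>ln (num_lines k)\<close>; both claims become
    limits of quotients.\<close>
  define S :: "nat \<Rightarrow> real" where
    "S k = ln 2 + 6 * ln (k + 1) + (k + 1) * (3 * ln (k + 1) + (k + 1) * ln 2)" for k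
  define P :: "nat \<Rightarrow> real" where
    "P k = k * (3 * ln k + k * ln 2) + k\<^sup>2 * ln 2 - (ln k + k * ln 4)" for k
  have S: "ln (real (graph_size (Suc k))) = S k" for k
    using ln_graph_size[of "Suc k"] by (simp add: S_def add_ac)
  have Spos: "\<forall>\<^sub>F k in at_top. 0 < S k"
    unfolding S_def by real_asymp
  have powr: "real (graph_size (Suc k)) powr x = exp (x * S k)" for k x
    using param_M_pos[of "Suc k"] by (simp add: powr_def S graph_size_def flip: S)
  have lines_pos: "0 < num_lines k" if "0 < k" for k
    using param_M_pos[OF that] that by (simp add: num_lines_def)
  have "(\<lambda>k. (P k - ln 2) / S k) \<longlonglongrightarrow> 2"
    unfolding P_def S_def by real_asymp
  then have "\<forall>\<^sub>F k in at_top. 2 - \<eta> < (P k - ln 2) / S k"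
    using assms by (intro order_tendstoD) auto
  with Spos eventually_gt_at_top[of 0]
  show "\<forall>\<^sub>F k in at_top. real (graph_size (Suc k)) powr (2 - \<eta>) \<le> num_lines k / 2"
  proof eventually_elim
    case (elim k)
    have "(2 - \<eta>) * S k \<le> P k - ln 2"
      using elim by (simp add: field_simps)
    also have "\<dots> = ln (num_lines k / 2)"
      using elim lines_pos[of k] by (simp add: ln_div ln_num_lines P_def)
    finally have "exp ((2 - \<eta>) * S k) \<le> exp (ln (num_lines k / 2))"
      by (simp only: exp_le_cancel_iff)
    then show ?case
      using lines_pos[of k] elim by (simp add: powr)
  qed
  define R :: "nat \<Rightarrow> real" where "R k = ln 4 + 3 * ln k + k * (3 * ln k + k * ln 2)" for k
  have "(\<lambda>k. (P k - R k) / S k) \<longlonglongrightarrow> 1"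
    unfolding P_def S_def R_def by real_asymp
  then have "\<forall>\<^sub>F k in at_top. 1 - \<eta> < (P k - R k) / S k"
    using assms by (intro order_tendstoD) auto
  with Spos eventually_gt_at_top[of 0]
  show "\<forall>\<^sub>F k in at_top. real (graph_size (Suc k)) powr (1 - \<eta>) \<le>
      num_lines k / (4 * k ^ 3 * param_M k)"
  proof eventually_elim
    case (elim k)
    have pos: "0 < real (4 * k ^ 3 * param_M k)"
      using elim param_M_pos by simp
    have "(1 - \<eta>) * S k \<le> P k - R k"
      using elim by (simp add: field_simps)
    also have "R k = ln (real (4 * k ^ 3 * param_M k))"
      using elim param_M_pos[of k] by (simp add: R_def ln_mult ln_realpow ln_param_M)
    also have "P k - \<dots> = ln (num_lines k / real (4 * k ^ 3 * param_M k))"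
      using elim lines_pos[of k] pos param_M_pos[of k] by (simp add: ln_div ln_num_lines P_def)
    finally have "exp ((1 - \<eta>) * S k) \<le> exp (ln (num_lines k / real (4 * k ^ 3 * param_M k)))"
      by (simp only: exp_le_cancel_iff)
    also have "\<dots> = num_lines k / real (4 * k ^ 3 * param_M k)"
      using lines_pos[of k] elim pos by (intro exp_ln divide_pos_pos) auto
    finally show ?case
      by (simp add: powr)
  qed
qed

section \<open>From the sizes \<open>graph_size k\<close> to every \<open>n\<close>\<close>

lemma graph_size_sandwich:
  assumes "graph_size k0 \<le> n"
  obtains k where "k0 \<le> k" "graph_size k \<le> n" "n < graph_size (Suc k)"
proof -
  have gt: "j < graph_size j" if "0 < j" for j
  proof -
    have "j * 1 \<le> (j ^ 3)\<^sup>2 * param_M j"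
      using that param_M_pos[OF that]
      by (intro mult_le_mono) (auto simp: Suc_le_eq intro!: self_le_power simp flip: power_mult)
    then show ?thesis
      using that by (simp add: graph_size_def)
  qed
  \<comment> \<open>The predecessor of the least index with size above \<open>n\<close> is the
    required \<open>k\<close>; such an index exists since \<open>j < graph_size j\<close>.\<close>
  define j where "j = (LEAST j. k0 \<le> j \<and> n < graph_size j)"
  have "k0 \<le> n + k0 + 1 \<and> n < graph_size (n + k0 + 1)"
    using gt[of "n + k0 + 1"] by simp
  then have j: "k0 \<le> j" "n < graph_size j"
    unfolding j_def by (metis (mono_tags, lifting) LeastI)+
  have "k0 < j"
    using assms j by (cases "k0 = j") auto
  then obtain k where k: "j = Suc k" "k0 \<le> k"
    by (cases j) auto
  have "\<not> (k0 \<le> k \<and> n < graph_size k)"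
    using not_less_Least[of k "\<lambda>j. k0 \<le> j \<and> n < graph_size j"] k(1) by (simp flip: j_def)
  then show thesis
    using that j k by auto
qed

text \<open>The additional arcs account for at most half of \<open>num_lines k\<close>; the other
  half is left to the DAGs, each realising at most \<open>2 * k ^ 3 * param_M k\<close>
  lines.\<close>

lemma eventually_hard:
  assumes "0 < \<eta>" "\<eta> \<le> 1"
  shows "\<forall>\<^sub>F n in at_top. \<exists>G. hard n \<eta> G"
proof -
  have "\<forall>\<^sub>F k in at_top. 16 \<le> k \<and> real (graph_size (Suc k)) powr (2 - \<eta>) \<le> num_lines k / 2 \<and>
      real (graph_size (Suc k)) powr (1 - \<eta>) \<le> num_lines k / (4 * k ^ 3 * param_M k)"
    using eventually_ge_at_top[of 16] eventually_graph_size_powr[OF assms(1)]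
    by eventually_elim simp
  then obtain k0 where k0: "\<And>k. k0 \<le> k \<Longrightarrow> 16 \<le> k"
      "\<And>k. k0 \<le> k \<Longrightarrow> real (graph_size (Suc k)) powr (2 - \<eta>) \<le> num_lines k / 2"
      "\<And>k. k0 \<le> k \<Longrightarrow> real (graph_size (Suc k)) powr (1 - \<eta>) \<le>
        num_lines k / (4 * k ^ 3 * param_M k)"
    unfolding eventually_at_top_linorder by blast
  have "\<exists>G. hard n \<eta> G" if n: "graph_size k0 \<le> n" for n
  proof -
    obtain k where k: "k0 \<le> k" "graph_size k \<le> n" "n < graph_size (Suc k)"
      by (rule graph_size_sandwich[OF n])
    obtain G :: "nat pair_pre_digraph" where G: "pair_digraph G" "card (pverts G) = n"
      "\<And>f g D. dag_cover G f g D \<Longrightarrow> reachability_preserving G g D \<Longrightarrow>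
        num_lines k \<le> real f + real g * (2 * k ^ 3 * param_M k)"
      using exists_hard_graph_param[OF k0(1)[OF k(1)] k(2)] by blast
    \<comment> \<open>Monotonicity needs a nonnegative exponent, whence
      \<open>\<eta> \<le> 1\<close>.\<close>
    have mono: "real n powr x \<le> real (graph_size (Suc k)) powr x" if "0 \<le> x" for x
      using k(3) that by (intro powr_mono2) auto
    have pos: "0 < real (4 * k ^ 3 * param_M k)"
      using k0(1)[OF k(1)] param_M_pos[of k] by simp
    have "real n powr (1 - \<eta>) \<le> real g"
      if "dag_cover G f g D" "reachability_preserving G g D" "real f \<le> real n powr (2 - \<eta>)"
      for f g D
    proof -
      have "real f \<le> num_lines k / 2"
        using that(3) mono[of "2 - \<eta>"] k0(2)[OF k(1)] assms by linarith
      then have "num_lines k / 2 \<le> real g * (2 * k ^ 3 * param_M k)"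
        using G(3)[OF that(1,2)] by simp
      then have "num_lines k / (4 * k ^ 3 * param_M k) \<le> real g"
        using pos by (simp add: divide_le_eq mult_ac)
      then show ?thesis
        using mono[of "1 - \<eta>"] k0(3)[OF k(1)] assms by linarith
    qed
    then show ?thesis
      using G by (auto simp: hard_def)
  qed
  then show ?thesis
    unfolding eventually_at_top_linorder by blast
qed

text \<open>For each \<open>n\<close> take the best rate \<open>1 / (m + 1)\<close> with
  \<open>m \<le> n\<close>. The cap makes the maximum exist, \<open>m = 0\<close> is always
  admissible, and each fixed \<open>j\<close> is eventually admissible, so \<open>m n\<close> tends
  to infinity.\<close>

lemma diagonal_rate:
  fixes P :: "nat \<Rightarrow> real \<Rightarrow> bool"
  assumes "\<And>n. P n 1" and "\<And>\<eta>. 0 < \<eta> \<Longrightarrow> \<eta> \<le> 1 \<Longrightarrow> \<forall>\<^sub>F n in at_top. P n \<eta>"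
  obtains \<epsilon> where "\<epsilon> \<longlonglongrightarrow> 0" "\<And>n. P n (\<epsilon> n)"
proof -
  define m where "m n = (GREATEST m. m \<le> n \<and> P n (inverse (real (Suc m))))" for n
  have m: "m n \<le> n \<and> P n (inverse (real (Suc (m n))))" for n
    unfolding m_def by (rule GreatestI_nat[of _ 0 n]) (use assms(1) in auto)
  have "filterlim m at_top at_top"
    unfolding filterlim_at_top
  proof
    fix j
    have "\<forall>\<^sub>F n in at_top. P n (inverse (real (Suc j)))"
      by (intro assms(2)) (auto simp: inverse_le_1_iff)
    with eventually_ge_at_top[of j] show "\<forall>\<^sub>F n in at_top. j \<le> m n"
    proof eventually_elim
      case (elim n)
      then show ?case
        unfolding m_def by (intro Greatest_le_nat[of _ _ n]) auto
    qed
  qed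
  then have "(\<lambda>n. inverse (real (Suc (m n)))) \<longlonglongrightarrow> 0"
    using filterlim_compose[OF LIMSEQ_inverse_real_of_nat] by blast
  then show thesis
    using m by (intro that[of "\<lambda>n. inverse (real (Suc (m n)))"]) auto
qed

theorem theorem1:
  shows "\<exists>(G :: nat \<Rightarrow> nat pair_pre_digraph) (\<epsilon> :: nat \<Rightarrow> real) (\<delta> :: nat \<Rightarrow> real).
    \<epsilon> \<in> o(\<lambda>_. 1) \<and> \<delta> \<in> o(\<lambda>_. 1) \<and>
    (\<forall>n. pair_digraph (G n) \<and> card (pverts (G n)) = n \<and>
      (\<forall>(f :: nat) (g :: nat) (D :: nat \<Rightarrow> nat pair_pre_digraph).
         dag_cover (G n) f g D \<and> reachability_preserving (G n) g D \<and>
         real f \<le> real n powr (2 - \<epsilon> n)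
         \<longrightarrow> real g \<ge> real n powr (1 - \<delta> n)))"
proof -
  obtain \<epsilon> where lim: "\<epsilon> \<longlonglongrightarrow> 0" and "\<And>n. \<exists>G. hard n (\<epsilon> n) G"
    using diagonal_rate[of "\<lambda>n \<eta>. \<exists>G. hard n \<eta> G"] hard_1 eventually_hard by blast
  then obtain G where "\<And>n. hard n (\<epsilon> n) (G n)"
    by metis
  moreover have "\<epsilon> \<in> o(\<lambda>_. 1)"
    using lim by (intro smalloI_tendsto) auto
  ultimately show ?thesis
    unfolding hard_def by blast
qed

end
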